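(* Let $1\le\alpha<2$. Let $G=(V,E)$ be a graph with distinct start vertex $s$ and end vertex $t$ such that every path in $G$ starting at $s$ can be extended to a Hamiltonian path from $s$ to $t$, and suppose every edge is announced with the same interval $[\ell(e),u(e)]=[1,\alpha]$. Then on every such GEEWE instance the Adaptive Exploration Algorithm incurs cost at most $\frac{\alpha+1}{2}\cdot\mathrm{OPT}$, i.e., it has competitive ratio at most $\frac{\alpha+1}{2}$.
   Context: Graph Exploration with Edge Weight Estimates (GEEWE): An instance consists of a connected graph $G=(V,E)$, for every edge $e$ a lower bound $\ell(e)$ and an upper bound $u(e)$, a start vertex $s$ and a distinct end vertex $t$, and actual weights $w(e)\in[\ell(e),u(e)]$. The graph and bounds are known in advance; the actual weight $w(e)$ is revealed as soon as the agent visits a vertex incident to $e$. The agent, starting at $s$, must perform a walk (repetitions allowed) from $s$ to $t$ visiting all vertices; its cost is the sum of actual weights of traversed edges with multiplicity. $\mathrm{OPT}$ is the minimum cost of such a walk with all actual weights known. Adaptive Exploration Algorithm: while not all vertices have been visited, the agent at its current vertex computes a shortest walk from its current vertex to $t$ visiting all still unvisited vertices, where revealed edges have their actual weights and unrevealed edges are assigned their upper bound $u(e)$ (worst case), and then moves to the next vertex on that walk. *)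

theory Defs
  imports Complex_Main
begin

definition simple_graph :: "'a set \<Rightarrow> 'a set set \<Rightarrow> bool" where
  "simple_graph V E \<longleftrightarrow> finite V \<and> (\<forall>e\<in>E. e \<subseteq> V \<and> card e = 2)"

definition walk :: "'a set \<Rightarrow> 'a set set \<Rightarrow> 'a list \<Rightarrow> bool" where
  "walk V E p \<longleftrightarrow> p \<noteq> [] \<and> set p \<subseteq> V \<and> successively (\<lambda>x y. {x, y} \<in> E) p"

definition connected_graph :: "'a set \<Rightarrow> 'a set set \<Rightarrow> bool" where
  "connected_graph V E \<longleftrightarrow>
     V \<noteq> {} \<and> (\<forall>x\<in>V. \<forall>y\<in>V. \<exists>p. walk V E p \<and> hd p = x \<and> last p = y)"

definition path :: "'a set \<Rightarrow> 'a set set \<Rightarrow> 'a list \<Rightarrow> bool" where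
  "path V E p \<longleftrightarrow> walk V E p \<and> distinct p"

definition hamiltonian_path :: "'a set \<Rightarrow> 'a set set \<Rightarrow> 'a \<Rightarrow> 'a \<Rightarrow> 'a list \<Rightarrow> bool" where
  "hamiltonian_path V E s t p \<longleftrightarrow> path V E p \<and> set p = V \<and> hd p = s \<and> last p = t"

fun walk_cost :: "('a set \<Rightarrow> real) \<Rightarrow> 'a list \<Rightarrow> real" where
  "walk_cost w (x # y # p) = w {x, y} + walk_cost w (y # p)"
| "walk_cost w _ = 0"

locale geewe_instance =
  fixes V :: "'a set" and E :: "'a set set"
    and l u :: "'a set \<Rightarrow> real"
    and s t :: 'a
    and w :: "'a set \<Rightarrow> real"
  assumes graph: "simple_graph V E"
    and connected: "connected_graph V E"
    and start: "s \<in> V" and target: "t \<in> V" and distinct: "s \<noteq> t"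
    and weights: "e \<in> E \<Longrightarrow> l e \<le> w e \<and> w e \<le> u e"

definition visiting_walk :: "'a set \<Rightarrow> 'a set set \<Rightarrow> 'a \<Rightarrow> 'a \<Rightarrow> 'a set \<Rightarrow> 'a list \<Rightarrow> bool" where
  "visiting_walk V E x t U p \<longleftrightarrow> walk V E p \<and> hd p = x \<and> last p = t \<and> U \<subseteq> set p"

text \<open>
  If the weights on \<open>E\<close> are bounded below by a positive constant, only finitely many walks cost
  less than any given bound, so on a connected graph the infimum is a minimum.
\<close>

definition OPT :: "'a set \<Rightarrow> 'a set set \<Rightarrow> 'a \<Rightarrow> 'a \<Rightarrow> ('a set \<Rightarrow> real) \<Rightarrow> real" where
  "OPT V E s t w = (INF p \<in> {p. visiting_walk V E s t V p}. walk_cost w p)"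

text \<open>
  The edges revealed to an agent that has visited the vertices in \<open>S\<close> are those incident to \<open>S\<close>.
\<close>

definition worst_case_weight ::
    "('a set \<Rightarrow> real) \<Rightarrow> ('a set \<Rightarrow> real) \<Rightarrow> 'a set \<Rightarrow> 'a set \<Rightarrow> real" where
  "worst_case_weight u w S e = (if e \<inter> S \<noteq> {} then w e else u e)"

text \<open>
  The state of the algorithm is the list \<open>h\<close> of vertices in the order in which the agent has been
  at them, so \<open>last h\<close> is its current vertex and \<open>set h\<close> the set of visited vertices. A step is a
  relation because a shortest walk need not be unique: ties may be broken arbitrarily.
\<close>

definition adaptive_step ::
    "'a set \<Rightarrow> 'a set set \<Rightarrow> ('a set \<Rightarrow> real) \<Rightarrow> 'a \<Rightarrow> ('a set \<Rightarrow> real) \<Rightarrow> 'a list \<Rightarrow> 'a list \<Rightarrow> bool"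
  where
  "adaptive_step V E u t w h h' \<longleftrightarrow>
     \<not> V \<subseteq> set h \<and>
     (\<exists>v q. is_arg_min (walk_cost (worst_case_weight u w (set h)))
              (visiting_walk V E (last h) t (V - set h)) (last h # v # q) \<and>
            h' = h @ [v])"

definition adaptive_terminates ::
    "'a set \<Rightarrow> 'a set set \<Rightarrow> ('a set \<Rightarrow> real) \<Rightarrow> 'a \<Rightarrow> 'a \<Rightarrow> ('a set \<Rightarrow> real) \<Rightarrow> bool" where
  "adaptive_terminates V E u s t w \<longleftrightarrow>
     \<not> (\<exists>H. H 0 = [s] \<and> (\<forall>i::nat. adaptive_step V E u t w (H i) (H (Suc i))))"

text \<open>
  The walks performed by the algorithm. A state without successor is one in which all vertices
  have been visited or no shortest walk exists.
\<close>

definition adaptive_run ::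
    "'a set \<Rightarrow> 'a set set \<Rightarrow> ('a set \<Rightarrow> real) \<Rightarrow> 'a \<Rightarrow> 'a \<Rightarrow> ('a set \<Rightarrow> real) \<Rightarrow> 'a list \<Rightarrow> bool" where
  "adaptive_run V E u s t w h \<longleftrightarrow>
     (adaptive_step V E u t w)\<^sup>*\<^sup>* [s] h \<and> \<not> (\<exists>h'. adaptive_step V E u t w h h')"

end

theory Submission
  imports Defs "HOL-Library.Sublist"
begin

text \<open>
  As long as \<open>\<alpha> < 2\<close>, reaching the next unvisited vertex by a detour costs at least 2, which is more
  than any direct edge. Hence the algorithm always follows a Hamiltonian path, and since all edges
  between unvisited vertices are estimated by \<open>\<alpha>\<close>, it greedily takes a cheapest edge to an unvisited
  vertex other than \<open>t\<close>.

  Let \<open>g x\<close> be the cost the algorithm pays for leaving \<open>x\<close>. By greediness, \<open>w {x, y}\<close> is at least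
  \<open>g x\<close> or \<open>g y\<close>, depending on which of the two was visited first. Listing the vertices other than
  \<open>t\<close> in an order in which an optimal walk visits them, starting with \<open>s\<close>, the walk pays at least \<open>g x\<close> or \<open>g y\<close>
  for each consecutive pair \<open>x, y\<close>: either it uses the edge, or it pays \<open>2 > \<alpha>\<close>. Every vertex is
  charged at most twice, and vertices charged twice compensate those not charged at all because
  \<open>\<alpha> + g x \<le> (\<alpha> + 1) / 2 * (2 * g x)\<close>. The final edge into \<open>t\<close> is paid for by the slack at \<open>s\<close>,
  which is charged exactly once.
\<close>

section \<open>Walk costs and shortcuts\<close>

lemma walk_Cons2:
  "walk V E (x # y # p) \<longleftrightarrow> x \<in> V \<and> {x, y} \<in> E \<and> walk V E (y # p)"
  by (auto simp: walk_def)

lemma walk_appendD2: "walk V E (p @ q) \<Longrightarrow> q \<noteq> [] \<Longrightarrow> walk V E q"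
  by (auto simp: walk_def successively_append_iff)

lemma walk_cost_append_last:
  "xs \<noteq> [] \<Longrightarrow> walk_cost c (xs @ [y]) = walk_cost c xs + c {last xs, y}"
  by (induction c xs rule: walk_cost.induct) auto

lemma walk_cost_Cons: "p \<noteq> [] \<Longrightarrow> walk_cost c (x # p) = c {x, hd p} + walk_cost c p"
  by (cases p) auto

lemma walk_cost_nonneg:
  assumes "walk V E p" and "\<And>e. e \<in> E \<Longrightarrow> 1 \<le> c e"
  shows "0 \<le> walk_cost c p"
  using assms
proof (induction c p rule: walk_cost.induct)
  case (1 c x y p)
  then have "0 \<le> walk_cost c (y # p)" "1 \<le> c {x, y}"
    by (auto simp: walk_Cons2)
  then show ?case by simp
qed auto

lemma walk_cost_ge_length:
  assumes "p \<noteq> []"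
    and "\<And>x y. x \<in> set p \<Longrightarrow> y \<in> set p \<Longrightarrow> b \<le> c {x, y}"
  shows "b * (real (length p) - 1) \<le> walk_cost c p"
  using assms
proof (induction c p rule: walk_cost.induct)
  case (1 c x y p)
  then have "b * (real (length (y # p)) - 1) \<le> walk_cost c (y # p)" "b \<le> c {x, y}"
    by auto
  then show ?case by (simp add: algebra_simps)
qed auto

text \<open>With edge costs at least 1, \<open>capped E c {x, y}\<close> bounds the cost of any nontrivial walk from \<open>x\<close>
  to \<open>y\<close> from below.\<close>
definition capped :: "'a set set \<Rightarrow> ('a set \<Rightarrow> real) \<Rightarrow> 'a set \<Rightarrow> real" where
  "capped E c e = (if e \<in> E then min 2 (c e) else 2)"

lemma capped_ge_one: "(\<And>e. e \<in> E \<Longrightarrow> 1 \<le> c e) \<Longrightarrow> 1 \<le> capped E c e"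
  by (simp add: capped_def)

text \<open>Between two consecutive entries of \<open>xs\<close> the walk either takes the edge
  joining them or traverses at least two edges of cost at least 1 each. The induction is on the
  length because the second case drops two vertices at once.\<close>

lemma capped_walk_cost_subseq:
  assumes "walk V E p" and "\<And>e. e \<in> E \<Longrightarrow> 1 \<le> c e" and "subseq xs p"
  shows "walk_cost (capped E c) xs \<le> walk_cost c p"
  using assms(1,3)
proof (induction "length p" arbitrary: p xs rule: less_induct)
  case less
  consider "length xs \<le> 1" | a b ys where "xs = a # b # ys"
    by (cases xs rule: remdups_adj.cases) auto
  then show ?case
  proof cases
    case 1
    then have "walk_cost (capped E c) xs = 0"
      by (cases xs rule: remdups_adj.cases) auto
    then show ?thesis
      using walk_cost_nonneg[OF less.prems(1) assms(2)] by simp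
  next
    case 2
    have "length p \<ge> 2"
      using list_emb_length[OF less.prems(2)] 2 by simp
    then obtain x y p' where p: "p = x # y # p'"
      by (cases p rule: remdups_adj.cases) auto
    have wp: "{x, y} \<in> E" "walk V E (y # p')"
      using less.prems(1) by (auto simp: p walk_Cons2)
    have cost: "walk_cost c p = c {x, y} + walk_cost c (y # p')" "1 \<le> c {x, y}"
      using assms(2) wp by (auto simp: p)
    show ?thesis
    proof (cases "x = a")
      case False
      then have "subseq xs (y # p')"
        using less.prems(2) by (simp add: p 2)
      then have "walk_cost (capped E c) xs \<le> walk_cost c (y # p')"
        using less.hyps[of "y # p'" xs] wp p by simp
      then show ?thesis using cost by simp
    next
      case True
      then have sub: "subseq (b # ys) (y # p')"
        using less.prems(2) by (simp add: p 2)
      show ?thesis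
      proof (cases "b = y")
        case True
        have "walk_cost (capped E c) (b # ys) \<le> walk_cost c (y # p')"
          using less.hyps[of "y # p'" "b # ys"] wp p sub by simp
        then show ?thesis
          using wp cost \<open>x = a\<close> True 2 by (simp add: capped_def)
      next
        case False
        then have sub': "subseq (b # ys) p'" using sub by simp
        then obtain z p'' where p': "p' = z # p''" by (cases p') auto
        have w': "{y, z} \<in> E" "walk V E p'"
          using wp by (auto simp: p' walk_Cons2)
        have "walk_cost (capped E c) (b # ys) \<le> walk_cost c p'"
          using less.hyps[of p' "b # ys"] w' p sub' by simp
        moreover have "walk_cost c (y # p') = c {y, z} + walk_cost c p'" "1 \<le> c {y, z}"
          using assms(2) w' by (auto simp: p')
        moreover have "capped E c {a, b} \<le> 2" by (simp add: capped_def)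
        ultimately show ?thesis using cost 2 by simp
      qed
    qed
  qed
qed

text \<open>Shortcuts a walk to its endpoints and one occurrence of every other vertex of
  \<open>A\<close>. The case \<open>hd p = t\<close> is included: it covers walks that enter
  \<open>t\<close> too early and must return to it.\<close>

lemma subseq_visiting_order:
  assumes "tl p \<noteq> []" and "last p = t" and "A \<subseteq> set p"
  obtains ys where "subseq (hd p # ys @ [t]) p" "distinct ys" "set ys = A - {hd p, t}"
proof -
  obtain v q where "p = v # q" "q \<noteq> []" using assms(1) by (cases p) auto
  then obtain r where p: "p = v # r @ [t]"
    using assms(2) by (metis append_butlast_last_id last_ConsR)
  define ys where "ys = remdups (filter (\<lambda>x. x \<in> A - {v, t}) r)"
  have "subseq (remdups xs) xs" for xs :: "'a list"
    by (induction xs) auto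
  then have "subseq ys r"
    unfolding ys_def by (meson subseq_filter_left subseq_order.trans)
  then have "subseq (hd p # ys @ [t]) p"
    by (simp add: p list_emb_append_mono)
  moreover have "set ys = A - {hd p, t}"
    using assms(3) by (auto simp: ys_def p)
  ultimately show thesis using that by (auto simp: ys_def)
qed

section \<open>Charging along a visiting order\<close>

text \<open>Adding a vertex at the front, the pair cost is charged to the new or to the old head. The maximum
  records whether the head has not been charged yet (first argument) or once (second argument).\<close>
lemma sum_list_le_charged_cost:
  fixes \<alpha> :: real
  assumes "xs \<noteq> []" and "\<And>x. x \<in> set xs \<Longrightarrow> 1 \<le> g x \<and> g x \<le> \<alpha>"
    and "successively (\<lambda>x y. g x \<le> d {x, y} \<or> g y \<le> d {x, y}) xs"
  shows "sum_list (map g xs) \<le> (\<alpha> + 1) / 2 * walk_cost d xs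
           + max (g (hd xs)) (\<alpha> - (\<alpha> - 1) / 2 * g (hd xs))"
  using assms
proof (induction xs rule: induct_list012)
  case (3 x y zs)
  let ?S = "sum_list (map g (y # zs))" and ?W = "walk_cost d (y # zs)"
  have IH: "?S \<le> (\<alpha> + 1) / 2 * ?W + max (g y) (\<alpha> - (\<alpha> - 1) / 2 * g y)"
    using 3 by simp
  have g: "1 \<le> g x" "g x \<le> \<alpha>" "1 \<le> g y" "g y \<le> \<alpha>"
    using "3.prems"(2) by auto
  consider "g x \<le> d {x, y}" | "g y \<le> d {x, y}" using "3.prems"(3) by auto
  then show ?case
  proof cases
    case 1
    \<comment> \<open>The pair pays for \<open>x\<close>, which is then charged once. Whichever term
      the maximum takes at \<open>y\<close>, it is at most \<alpha>, the constant in the second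
      argument for \<open>x\<close>.\<close>
    have "(\<alpha> + 1) / 2 * g x \<le> (\<alpha> + 1) / 2 * d {x, y}"
      using 1 g by (intro mult_left_mono) auto
    moreover have "(\<alpha> - 1) * 1 \<le> (\<alpha> - 1) * g y" using g by (intro mult_left_mono) auto
    then have "max (g y) (\<alpha> - (\<alpha> - 1) / 2 * g y) \<le> \<alpha>" using g by auto
    moreover have "(\<alpha> + 1) / 2 * g x = g x + (\<alpha> - 1) / 2 * g x"
      by (simp add: field_simps)
    ultimately have "g x + ?S \<le> (\<alpha> + 1) / 2 * (d {x, y} + ?W) + (\<alpha> - (\<alpha> - 1) / 2 * g x)"
      unfolding distrib_left[of _ "d {x, y}"] using IH by linarith
    then show ?thesis by simp
  next
    case 2
    \<comment> \<open>The pair pays for \<open>y\<close> and thereby covers both possible terms of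
      the maximum at \<open>y\<close>; the head \<open>x\<close> stays uncharged.\<close>
    have "(\<alpha> + 1) / 2 * g y \<le> (\<alpha> + 1) / 2 * d {x, y}"
      using 2 g by (intro mult_left_mono) auto
    moreover have "\<alpha> * 1 \<le> \<alpha> * g y" "1 * g y \<le> \<alpha> * g y"
      using g by (intro mult_left_mono mult_right_mono; simp)+
    then have "max (g y) (\<alpha> - (\<alpha> - 1) / 2 * g y) \<le> (\<alpha> + 1) / 2 * g y"
      by (intro max.boundedI) (simp_all add: field_simps)
    ultimately have "g x + ?S \<le> (\<alpha> + 1) / 2 * (d {x, y} + ?W) + g x"
      unfolding distrib_left[of _ "d {x, y}"] using IH by linarith
    then show ?thesis by simp
  qed
qed auto

section \<open>Greedy paths\<close>

text \<open>On leaving \<open>x\<close> the visited vertices are those of \<open>p\<close> and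
  \<open>x\<close> itself. The end vertex \<open>t\<close> is no competitor because it has to be
  kept for last.\<close>

definition greedy_path ::
    "'a set \<Rightarrow> 'a set set \<Rightarrow> ('a set \<Rightarrow> real) \<Rightarrow> 'a \<Rightarrow> 'a list \<Rightarrow> bool" where
  "greedy_path V E w t h \<longleftrightarrow>
     (\<forall>p x y r. h = p @ x # y # r \<longrightarrow>
        (\<forall>z \<in> V - set p - {x, t}. {x, z} \<in> E \<longrightarrow> w {x, y} \<le> w {x, z}))"

text \<open>The head has to leave the vertex set too: once removed from the list, it would count as
  unvisited.\<close>

lemma greedy_path_ConsD:
  assumes "greedy_path V E w t (x # h)"
  shows "greedy_path (V - {x}) E w t h"
  unfolding greedy_path_def
proof (intro allI impI ballI)
  fix p a y r z
  assume "h = p @ a # y # r" "z \<in> V - {x} - set p - {a, t}" "{a, z} \<in> E"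
  then have "x # h = (x # p) @ a # y # r" "z \<in> V - set (x # p) - {a, t}" by auto
  then show "w {a, y} \<le> w {a, z}"
    using assms \<open>{a, z} \<in> E\<close> unfolding greedy_path_def by blast
qed

lemma greedy_path_ConsConsD:
  assumes "greedy_path V E w t (x # y # h)" and "z \<in> V - {x, t}" and "{x, z} \<in> E"
  shows "w {x, y} \<le> w {x, z}"
proof -
  have "x # y # h = [] @ x # y # h" "z \<in> V - set [] - {x, t}" using assms(2) by auto
  then show ?thesis using assms(1,3) unfolding greedy_path_def by blast
qed

lemma greedy_path_snoc:
  assumes "greedy_path V E w t h"
    and "\<And>z. z \<in> V - set h - {t} \<Longrightarrow> {last h, z} \<in> E \<Longrightarrow> w {last h, v} \<le> w {last h, z}"
  shows "greedy_path V E w t (h @ [v])"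
  unfolding greedy_path_def
proof (intro allI impI ballI)
  fix p x y r z
  assume h: "h @ [v] = p @ x # y # r" and z: "z \<in> V - set p - {x, t}" "{x, z} \<in> E"
  show "w {x, y} \<le> w {x, z}"
  proof (cases r rule: rev_cases)
    case Nil
    then have "h = p @ [x]" "y = v" using h by auto
    then show ?thesis using assms(2)[of z] z by auto
  next
    case (snoc r' v')
    then have "h = p @ x # y # r'" using h by auto
    then show ?thesis using assms(1) z unfolding greedy_path_def by blast
  qed
qed

text \<open>The function \<open>g\<close> maps each vertex to the cost of the path edge leaving it.\<close>
lemma greedy_path_charges:
  assumes "h \<noteq> []" and "distinct h" and "last h = t" and "walk V' E h"
    and "greedy_path (set h) E w t h"
    and "\<And>e. e \<in> E \<Longrightarrow> 1 \<le> w e \<and> w e \<le> \<alpha>"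
  shows "\<exists>g. walk_cost w h = (\<Sum>x \<in> set h - {t}. g x) \<and>
    (\<forall>x \<in> set h - {t}. 1 \<le> g x \<and> g x \<le> \<alpha>) \<and>
    (\<forall>x \<in> set h - {t}. \<forall>z \<in> set h - {t}. {x, z} \<in> E \<longrightarrow> x \<noteq> z \<longrightarrow>
        g x \<le> w {x, z} \<or> g z \<le> w {x, z}) \<and>
    (\<forall>z. hd h \<noteq> t \<longrightarrow> z \<in> set (tl h) \<longrightarrow> (z = t \<longrightarrow> tl h = [t]) \<longrightarrow>
        {hd h, z} \<in> E \<longrightarrow> g (hd h) \<le> w {hd h, z})"
  using assms(1-5)
proof (induction h rule: induct_list012)
  case (2 x)
  then show ?case by auto
next
  case (3 x y h)
  have dec: "set (x # y # h) - {x} = set (y # h)" using "3.prems"(2) by auto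
  have t: "t \<in> set (y # h)" "x \<noteq> t"
    using "3.prems"(2,3) by (auto split: if_splits)
  have gp: "greedy_path (set (y # h)) E w t (y # h)"
    using greedy_path_ConsD[OF "3.prems"(5)] dec by simp
  obtain g where g: "walk_cost w (y # h) = (\<Sum>x \<in> set (y # h) - {t}. g x)"
      "\<forall>x \<in> set (y # h) - {t}. 1 \<le> g x \<and> g x \<le> \<alpha>"
      "\<forall>x \<in> set (y # h) - {t}. \<forall>z \<in> set (y # h) - {t}. {x, z} \<in> E \<longrightarrow> x \<noteq> z \<longrightarrow>
        g x \<le> w {x, z} \<or> g z \<le> w {x, z}"
    using "3.IH"(2) "3.prems" gp by (auto simp: walk_Cons2)
  let ?g = "g(x := w {x, y})"
  have e: "{x, y} \<in> E" using "3.prems"(4) by (simp add: walk_Cons2)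
  \<comment> \<open>Among the vertices of this path, \<open>x\<close> is left first, so in every
    pair containing \<open>x\<close> the greedy choice lets \<open>x\<close> be the one
    charged.\<close>
  have min: "w {x, y} \<le> w {x, z}" if "z \<in> set (y # h) - {t}" "{x, z} \<in> E" for z
    using greedy_path_ConsConsD[OF "3.prems"(5) _ that(2)] that(1) "3.prems"(2) by auto
  have x: "x \<notin> set (y # h)" using "3.prems"(2) by simp
  have split: "set (x # y # h) - {t} = insert x (set (y # h) - {t})" using t by auto
  have "(\<Sum>v \<in> set (y # h) - {t}. ?g v) = (\<Sum>v \<in> set (y # h) - {t}. g v)"
    using x by (intro sum.cong) auto
  then have sum: "walk_cost w (x # y # h) = (\<Sum>v \<in> set (x # y # h) - {t}. ?g v)"
    unfolding split using x g(1) by (subst sum.insert) auto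
  have bounds: "\<forall>v \<in> set (x # y # h) - {t}. 1 \<le> ?g v \<and> ?g v \<le> \<alpha>"
    unfolding split using g(2) assms(6)[OF e] by auto
  have pairs: "?g a \<le> w {a, z} \<or> ?g z \<le> w {a, z}"
    if "a \<in> set (x # y # h) - {t}" "z \<in> set (x # y # h) - {t}" "{a, z} \<in> E" "a \<noteq> z" for a z
  proof -
    consider "a = x" | "z = x" | "a \<noteq> x" "z \<noteq> x" by blast
    then show ?thesis
    proof cases
      case 1
      then show ?thesis using min[of z] that by auto
    next
      case 2
      then show ?thesis using min[of a] that by (auto simp: insert_commute)
    next
      case 3
      then show ?thesis using g(3) that by auto
    qed
  qed
  \<comment> \<open>For \<open>z = t\<close> the path consists of a single edge, and both sides are
    its weight.\<close>
  have head: "?g x \<le> w {x, z}"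
    if "z \<in> set (y # h)" "z = t \<longrightarrow> y # h = [t]" "{x, z} \<in> E" for z
    using that min[of z] by (cases "z = t") auto
  show ?case
    by (rule exI[of _ ?g]) (use sum bounds pairs head in auto)
qed auto

section \<open>The first step of a shortest walk\<close>

text \<open>Extension is demanded only of paths avoiding \<open>t\<close>: a path containing
  \<open>t\<close> has a Hamiltonian extension ending in \<open>t\<close> only if it is Hamiltonian
  with end \<open>t\<close> already.\<close>

locale extendable_instance = geewe_instance +
  fixes \<alpha> :: real
  assumes alpha: "1 \<le> \<alpha>" "\<alpha> < 2"
    and bounds: "e \<in> E \<Longrightarrow> l e = 1 \<and> u e = \<alpha>"
    and extendable:
      "path V E p \<Longrightarrow> hd p = s \<Longrightarrow> t \<notin> set p \<Longrightarrow> \<exists>q. hamiltonian_path V E s t (p @ q)"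
begin

lemma w_bounds: "e \<in> E \<Longrightarrow> 1 \<le> w e" "e \<in> E \<Longrightarrow> w e \<le> \<alpha>"
  using weights bounds by force+

lemma finite_V: "finite V"
  using graph by (simp add: simple_graph_def)

lemma worst_case_ge_one: "e \<in> E \<Longrightarrow> 1 \<le> worst_case_weight u w S e"
  using w_bounds(1) bounds alpha by (simp add: worst_case_weight_def)

lemma walk_cost_unvisited:
  assumes "walk V E p" and "set p \<inter> S = {}"
  shows "walk_cost (worst_case_weight u w S) p = \<alpha> * (real (length p) - 1)"
  using assms
proof (induction "worst_case_weight u w S" p rule: walk_cost.induct)
  case (1 x y p)
  then have "{x, y} \<in> E" and
    "walk_cost (worst_case_weight u w S) (y # p) = \<alpha> * (real (length (y # p)) - 1)"
    by (auto simp: walk_Cons2)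
  moreover from this have "worst_case_weight u w S {x, y} = \<alpha>"
    using 1 bounds by (auto simp: worst_case_weight_def)
  ultimately show ?case by (simp add: algebra_simps)
qed (auto simp: walk_def)

text \<open>For a path \<open>h\<close> from \<open>s\<close> avoiding \<open>t\<close>,
  extendability makes these exactly the vertices that can follow \<open>h\<close> on a Hamiltonian
  path from \<open>s\<close> to \<open>t\<close>.\<close>

definition candidates :: "'a list \<Rightarrow> 'a set" where
  "candidates h = {x \<in> V - set h. {last h, x} \<in> E \<and> (x = t \<longrightarrow> V - set h = {t})}"

context
  fixes h :: "'a list"
  assumes h: "path V E h" "hd h = s" "t \<notin> set h"
begin

lemma h_nonempty: "h \<noteq> []"
  using h by (auto simp: path_def walk_def)

lemma worst_case_next: "worst_case_weight u w (set h) {last h, x} = w {last h, x}"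
  using h_nonempty by (simp add: worst_case_weight_def)

lemma candidates_nonempty: "candidates h \<noteq> {}"
proof -
  obtain q where q: "hamiltonian_path V E s t (h @ q)"
    using extendable h by blast
  then have "q \<noteq> []" using h target by (auto simp: hamiltonian_path_def)
  then obtain x r where qx: "q = x # r" by (cases q) auto
  have walk: "walk V E (h @ x # r)" and dist: "distinct (h @ x # r)"
    and set: "set (h @ x # r) = V" and last: "last (h @ x # r) = t"
    using q by (auto simp: hamiltonian_path_def path_def qx)
  have "{last h, x} \<in> E"
    using walk h_nonempty by (auto simp: walk_def successively_append_iff)
  moreover have "x \<in> V - set h" using set dist by auto
  moreover have "V - set h = {t}" if "x = t"
  proof -
    have "r = []" using last dist that by (cases r rule: rev_cases) auto
    then show ?thesis using set dist that by auto
  qed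
  ultimately have "x \<in> candidates h" by (simp add: candidates_def)
  then show ?thesis by blast
qed

text \<open>Follow a Hamiltonian extension of \<open>h @ [x]\<close>. Only its edge into
  \<open>x\<close> is revealed; the remaining edges join unvisited vertices and are estimated by
  \<alpha>.\<close>

lemma candidate_walk:
  assumes "x \<in> candidates h"
  obtains q where "visiting_walk V E (last h) t (V - set h) (last h # x # q)"
    "walk_cost (worst_case_weight u w (set h)) (last h # x # q)
       = w {last h, x} + \<alpha> * (real (card (V - set h)) - 1)"
proof -
  have x: "x \<in> V" "x \<notin> set h" "{last h, x} \<in> E" "x = t \<Longrightarrow> V - set h = {t}"
    using assms by (auto simp: candidates_def)
  have path: "path V E (h @ [x])"
    using h(1) x by (auto simp: path_def walk_def successively_append_iff)
  obtain q where q: "walk V E (x # q)" "last (x # q) = t" "set (x # q) = V - set h"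
    "distinct (x # q)"
  proof (cases "x = t")
    case True
    then show ?thesis using that[of "[]"] x by (auto simp: walk_def)
  next
    case False
    then obtain q where q: "hamiltonian_path V E s t ((h @ [x]) @ q)"
      using extendable[OF path] h h_nonempty by auto
    then have "walk V E (h @ x # q)" "distinct (h @ x # q)" "set (h @ x # q) = V"
      "last (h @ x # q) = t"
      by (auto simp: hamiltonian_path_def path_def)
    then show ?thesis using that[of q] walk_appendD2[of V E h "x # q"] by auto
  qed
  have "last h \<in> V" using h(1) h_nonempty by (auto simp: path_def walk_def)
  then have "visiting_walk V E (last h) t (V - set h) (last h # x # q)"
    using q x by (auto simp: visiting_walk_def walk_Cons2)
  moreover have "length (x # q) = card (V - set h)"
    using q by (metis distinct_card)
  then have "walk_cost (worst_case_weight u w (set h)) (x # q)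
      = \<alpha> * (real (card (V - set h)) - 1)"
    using walk_cost_unvisited[OF q(1), of "set h"] q(3) by auto
  ultimately show thesis using that worst_case_next by simp
qed

text \<open>Visiting the unvisited vertices one after another takes
  \<open>card (V - set h) - 1\<close> hops of cost at least \<alpha>. A first step to a
  non-candidate, that is to a visited vertex or prematurely to \<open>t\<close>, adds an edge into
  that vertex and a hop out of it, each costing at least 1.\<close>

lemma visiting_walk_cost_ge:
  assumes "visiting_walk V E (last h) t (V - set h) p"
  obtains v q where "p = last h # v # q"
    "v \<in> candidates h \<Longrightarrow> w {last h, v} + \<alpha> * (real (card (V - set h)) - 1)
       \<le> walk_cost (worst_case_weight u w (set h)) p"
    "v \<notin> candidates h \<Longrightarrow> 2 + \<alpha> * (real (card (V - set h)) - 1)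
       \<le> walk_cost (worst_case_weight u w (set h)) p"
proof -
  let ?c = "worst_case_weight u w (set h)" and ?U = "V - set h"
  have walk: "walk V E p" and ends: "hd p = last h" "last p = t" and vis: "?U \<subseteq> set p"
    using assms by (auto simp: visiting_walk_def)
  have "last h \<noteq> t" using h(3) h_nonempty by auto
  then have "length p \<ge> 2"
    using walk ends by (cases p rule: remdups_adj.cases) (auto simp: walk_def)
  then obtain v q where p: "p = last h # v # q"
    using ends by (cases p rule: remdups_adj.cases) auto
  have e: "{last h, v} \<in> E" and walk': "walk V E (v # q)"
    using walk by (auto simp: p walk_Cons2)
  have U: "?U \<subseteq> set (v # q)" "last (v # q) = t" "t \<in> ?U"
    using vis h_nonempty ends target h(3) by (auto simp: p)
  have cost: "walk_cost ?c p = w {last h, v} + walk_cost ?c (v # q)"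
    using worst_case_next by (simp add: p)
  \<comment> \<open>Edges between unvisited vertices are unrevealed and estimated by \<alpha>; for
    non-edges and for the cap, 2 exceeds \<alpha>.\<close>
  have cap: "\<alpha> \<le> capped E ?c {x, y}" if "x \<in> ?U" "y \<in> ?U" for x y
    using that bounds alpha by (auto simp: capped_def worst_case_weight_def)
  \<comment> \<open>The conditional bounds the hop leaving \<open>v\<close>; the other summand
    bounds the hops along \<open>ys @ [t]\<close>, where \<open>ys\<close> lists the unvisited
    vertices other than \<open>v\<close> and \<open>t\<close>.\<close>
  have tail: "(if v \<in> ?U - {t} then \<alpha> else 1) + \<alpha> * real (card ?U - card ({v, t} \<inter> ?U))
      \<le> walk_cost ?c (v # q)"
    if q: "q \<noteq> []"
  proof -
    obtain ys where ys: "subseq (v # ys @ [t]) (v # q)" "distinct ys" "set ys = ?U - {v, t}"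
      by (rule subseq_visiting_order[of "v # q" t ?U]) (use q U in simp_all)
    have len: "length ys = card ?U - card ({v, t} \<inter> ?U)"
      using ys distinct_card[of ys] finite_V by (simp add: card_Diff_subset_Int Int_commute)
    have "\<alpha> * (real (length (ys @ [t])) - 1) \<le> walk_cost (capped E ?c) (ys @ [t])"
      using ys U by (intro walk_cost_ge_length cap) auto
    moreover have "walk_cost (capped E ?c) (v # ys @ [t])
        = capped E ?c {v, hd (ys @ [t])} + walk_cost (capped E ?c) (ys @ [t])"
      by (rule walk_cost_Cons) simp
    moreover have "walk_cost (capped E ?c) (v # ys @ [t]) \<le> walk_cost ?c (v # q)"
      using capped_walk_cost_subseq[OF walk' worst_case_ge_one ys(1)] by auto
    moreover have "(if v \<in> ?U - {t} then \<alpha> else 1) \<le> capped E ?c {v, hd (ys @ [t])}"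
    proof (cases "v \<in> ?U - {t}")
      case True
      have "hd (ys @ [t]) \<in> ?U" using ys(3) U(3) by (cases ys) auto
      then show ?thesis using True cap by auto
    qed (use capped_ge_one[OF worst_case_ge_one] in auto)
    ultimately show ?thesis by (simp add: len)
  qed
  have finU: "finite ?U" "card ?U \<ge> 1"
    using finite_V U(3) by (auto simp: Suc_le_eq card_gt_0_iff)
  show thesis
  proof (rule that[OF p])
    assume v: "v \<in> candidates h"
    show "w {last h, v} + \<alpha> * (real (card ?U) - 1) \<le> walk_cost ?c p"
    proof (cases "v = t")
      case True
      then have "?U = {t}" using v by (simp add: candidates_def)
      then show ?thesis
        using cost walk_cost_nonneg[OF walk' worst_case_ge_one] by (simp add: algebra_simps)
    next
      case False
      then have "{v, t} \<subseteq> ?U" using v U(3) by (auto simp: candidates_def)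
      then have "card ({v, t} \<inter> ?U) = 2" "v \<in> ?U - {t}" "card ?U \<ge> 2"
        using False card_mono[of ?U "{v, t}"] finU by (auto simp: Int_absorb2)
      moreover have "q \<noteq> []" using U(2) False by auto
      ultimately show ?thesis using tail cost by (simp add: of_nat_diff algebra_simps)
    qed
  next
    assume v: "v \<notin> candidates h"
    have vV: "v \<in> V" using walk' by (simp add: walk_def)
    then have vt: "v \<notin> ?U - {t}" using v e by (auto simp: candidates_def)
    then have "{v, t} \<inter> ?U = {t}" using U(3) by auto
    moreover have "q \<noteq> []"
    proof
      assume "q = []"
      then have "v = t" "?U = {t}" using U by auto
      then show False using v e vV U(3) by (simp add: candidates_def)
    qed
    moreover have "1 \<le> w {last h, v}" using w_bounds e by blast
    ultimately show "2 + \<alpha> * (real (card ?U) - 1) \<le> walk_cost ?c p"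
      using tail[unfolded if_not_P[OF vt]] cost finU by (simp add: of_nat_diff)
  qed
qed

text \<open>Some candidate achieves at most \<open>\<alpha> + ?K\<close>, which rules out
  non-candidates with their bound \<open>2 + ?K\<close>. Between candidates only the first edge
  makes a difference.\<close>

lemma shortest_walk_first_step:
  assumes "is_arg_min (walk_cost (worst_case_weight u w (set h)))
     (visiting_walk V E (last h) t (V - set h)) (last h # v # q)"
  shows "v \<in> candidates h \<and> (\<forall>x \<in> candidates h. w {last h, v} \<le> w {last h, x})"
proof -
  let ?c = "worst_case_weight u w (set h)" and ?K = "\<alpha> * (real (card (V - set h)) - 1)"
  have min: "walk_cost ?c (last h # v # q) \<le> w {last h, x} + ?K" if "x \<in> candidates h" for x
  proof -
    obtain r where "visiting_walk V E (last h) t (V - set h) (last h # x # r)"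
      "walk_cost ?c (last h # x # r) = w {last h, x} + ?K"
      using candidate_walk \<open>x \<in> candidates h\<close> by blast
    then show ?thesis using assms by (metis is_arg_min_linorder)
  qed
  have vis: "visiting_walk V E (last h) t (V - set h) (last h # v # q)"
    using assms by (simp add: is_arg_min_def)
  have lower: "v \<in> candidates h \<Longrightarrow> w {last h, v} + ?K \<le> walk_cost ?c (last h # v # q)"
    "v \<notin> candidates h \<Longrightarrow> 2 + ?K \<le> walk_cost ?c (last h # v # q)"
    by (rule visiting_walk_cost_ge[OF vis]; simp)+
  have "v \<in> candidates h"
  proof (rule ccontr)
    assume v: "v \<notin> candidates h"
    obtain x where x: "x \<in> candidates h" using candidates_nonempty by blast
    then have "w {last h, x} \<le> \<alpha>" using w_bounds by (simp add: candidates_def)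
    then show False using min[OF x] lower(2)[OF v] alpha by simp
  qed
  then show ?thesis using lower(1) min by fastforce
qed

text \<open>Continuing a cheapest candidate along a Hamiltonian path attains the lower bound for
  visiting walks, so a shortest walk exists and the algorithm cannot get stuck before reaching
  \<open>t\<close>.\<close>

lemma adaptive_step_exists: "\<exists>h'. adaptive_step V E u t w h h'"
proof -
  let ?c = "worst_case_weight u w (set h)" and ?K = "\<alpha> * (real (card (V - set h)) - 1)"
  have fin: "finite (candidates h)" using finite_V by (simp add: candidates_def)
  define x where "x = arg_min_on (\<lambda>x. w {last h, x}) (candidates h)"
  have x: "x \<in> candidates h" "\<And>v. v \<in> candidates h \<Longrightarrow> w {last h, x} \<le> w {last h, v}"
    unfolding x_def using fin candidates_nonempty
    by (auto intro: arg_min_if_finite(1) arg_min_least)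
  obtain q where q: "visiting_walk V E (last h) t (V - set h) (last h # x # q)"
    "walk_cost ?c (last h # x # q) = w {last h, x} + ?K"
    using candidate_walk[OF x(1)] by blast
  have "w {last h, x} \<le> 2" using x(1) w_bounds alpha by (force simp: candidates_def)
  have "walk_cost ?c (last h # x # q) \<le> walk_cost ?c p"
    if "visiting_walk V E (last h) t (V - set h) p" for p
  proof (rule visiting_walk_cost_ge[OF that])
    fix v q'
    assume "p = last h # v # q'"
      "v \<in> candidates h \<Longrightarrow> w {last h, v} + ?K \<le> walk_cost ?c p"
      "v \<notin> candidates h \<Longrightarrow> 2 + ?K \<le> walk_cost ?c p"
    then show ?thesis
      using x(2)[of v] q(2) \<open>w {last h, x} \<le> 2\<close> by (cases "v \<in> candidates h") auto
  qed
  then have "is_arg_min (walk_cost ?c) (visiting_walk V E (last h) t (V - set h)) (last h # x # q)"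
    using q(1) by (simp add: is_arg_min_linorder)
  then show ?thesis using target h(3) unfolding adaptive_step_def by blast
qed

end

section \<open>Invariant and termination of the algorithm\<close>

text \<open>The last conjunct makes \<open>t \<notin> set h\<close> equivalent to the exploration
  being unfinished, so the results on the first step apply to every state that has a
  successor.\<close>

definition reachable_state :: "'a list \<Rightarrow> bool" where
  "reachable_state h \<longleftrightarrow> path V E h \<and> hd h = s \<and> greedy_path V E w t h \<and>
     (t \<in> set h \<longrightarrow> set h = V \<and> last h = t)"

lemma reachable_state_init: "reachable_state [s]"
  using start distinct
  by (auto simp: reachable_state_def path_def walk_def greedy_path_def Cons_eq_append_conv)

lemma reachable_state_step:
  assumes "reachable_state h" and "adaptive_step V E u t w h h'"
  shows "reachable_state h' \<and> length h' = Suc (length h)"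
proof -
  have h: "path V E h" "hd h = s" "greedy_path V E w t h" "t \<notin> set h"
    using assms by (auto simp: reachable_state_def adaptive_step_def)
  obtain v q where v: "is_arg_min (walk_cost (worst_case_weight u w (set h)))
     (visiting_walk V E (last h) t (V - set h)) (last h # v # q)" and h': "h' = h @ [v]"
    using assms(2) by (auto simp: adaptive_step_def)
  have step: "v \<in> candidates h" "\<And>x. x \<in> candidates h \<Longrightarrow> w {last h, v} \<le> w {last h, x}"
    using shortest_walk_first_step[OF h(1,2,4) v] by auto
  have v': "v \<in> V" "v \<notin> set h" "{last h, v} \<in> E" "v = t \<Longrightarrow> V - set h = {t}"
    using step(1) by (auto simp: candidates_def)
  have sub: "set h \<subseteq> V" "h \<noteq> []" using h(1) by (auto simp: path_def walk_def)
  have "path V E h'"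
    using h(1) v' by (auto simp: h' path_def walk_def successively_append_iff)
  moreover have "greedy_path V E w t h'"
    unfolding h' using h(3) step(2)
    by (intro greedy_path_snoc) (auto simp: candidates_def)
  moreover have "set h' = V \<and> last h' = t" if "t \<in> set h'"
  proof -
    have "v = t" using that h(4) by (simp add: h')
    then show ?thesis using v' sub target by (auto simp: h')
  qed
  ultimately show ?thesis using h(2) sub by (auto simp: reachable_state_def h')
qed

text \<open>Every state is a list of distinct vertices and each step lengthens it, so after
  \<open>card V\<close> steps there would be one vertex too many.\<close>

lemma adaptive_terminates: "adaptive_terminates V E u s t w"
  unfolding adaptive_terminates_def
proof
  assume "\<exists>H. H 0 = [s] \<and> (\<forall>i::nat. adaptive_step V E u t w (H i) (H (Suc i)))"
  then obtain H where H: "H 0 = [s]" "\<And>i::nat. adaptive_step V E u t w (H i) (H (Suc i))"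
    by blast
  have inv: "reachable_state (H i) \<and> length (H i) = Suc i" for i
    by (induction i) (use H reachable_state_init reachable_state_step in auto)
  have "distinct (H (card V))" "set (H (card V)) \<subseteq> V" "length (H (card V)) = Suc (card V)"
    using inv[of "card V"] by (auto simp: reachable_state_def path_def walk_def)
  then show False
    using card_mono[OF finite_V] by (metis distinct_card not_less_eq_eq order_refl)
qed

lemma adaptive_run_greedy:
  assumes "adaptive_run V E u s t w h"
  shows "hamiltonian_path V E s t h \<and> greedy_path V E w t h"
proof -
  have "(adaptive_step V E u t w)\<^sup>*\<^sup>* [s] h" and final: "\<not> (\<exists>h'. adaptive_step V E u t w h h')"
    using assms by (auto simp: adaptive_run_def)
  from this(1) have "reachable_state h"
    by induction (use reachable_state_init reachable_state_step in auto)
  moreover from this final have "t \<in> set h"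
    using adaptive_step_exists by (auto simp: reachable_state_def)
  ultimately show ?thesis by (auto simp: reachable_state_def hamiltonian_path_def)
qed

section \<open>The competitive ratio\<close>

lemma greedy_cost_le:
  assumes "hamiltonian_path V E s t h" and "greedy_path V E w t h"
    and "visiting_walk V E s t V p"
  shows "walk_cost w h \<le> (\<alpha> + 1) / 2 * walk_cost w p"
proof -
  have h: "walk V E h" "distinct h" "set h = V" "hd h = s" "last h = t" "h \<noteq> []"
    using assms(1) by (auto simp: hamiltonian_path_def path_def walk_def)
  have tl: "set (tl h) = V - {s}" using h by (cases h) auto
  obtain g where sum: "walk_cost w h = (\<Sum>x \<in> V - {t}. g x)"
    and g: "\<And>x. x \<in> V - {t} \<Longrightarrow> 1 \<le> g x \<and> g x \<le> \<alpha>"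
    and pair: "\<And>x z. x \<in> V - {t} \<Longrightarrow> z \<in> V - {t} \<Longrightarrow> {x, z} \<in> E \<Longrightarrow> x \<noteq> z \<Longrightarrow>
        g x \<le> w {x, z} \<or> g z \<le> w {x, z}"
    and gs: "\<And>z. z \<in> V - {s} \<Longrightarrow> (z = t \<Longrightarrow> tl h = [t]) \<Longrightarrow> {s, z} \<in> E \<Longrightarrow> g s \<le> w {s, z}"
    using greedy_path_charges[OF h(6,2,5,1), of w \<alpha>] assms(2) w_bounds
    unfolding h(3,4) tl using distinct by metis
  have p: "walk V E p" "hd p = s" "last p = t" "V \<subseteq> set p"
    using assms(3) by (auto simp: visiting_walk_def)
  have "tl p \<noteq> []" using p distinct by (cases p) (auto simp: walk_def)
  then obtain ys where ys: "subseq (s # ys @ [t]) p" "distinct ys" "set ys = V - {s, t}"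
    using subseq_visiting_order[of p t V] p by auto
  let ?d = "capped E w"
  have le: "walk_cost ?d (s # ys @ [t]) \<le> walk_cost w p"
    using capped_walk_cost_subseq[OF p(1) w_bounds(1) ys(1)] by auto
  \<comment> \<open>The cap is harmless since \<open>g x\<close> is at most \<alpha>, which is below
    2; only actual edges call for an argument.\<close>
  have gd: "g x \<le> ?d {x, y}" if "x \<in> V - {t}" "{x, y} \<in> E \<Longrightarrow> g x \<le> w {x, y}" for x y
    using that g[of x] alpha by (auto simp: capped_def)
  have sV: "s \<in> V - {t}" using start distinct by simp
  have "walk_cost w h \<le> (\<alpha> + 1) / 2 * walk_cost ?d (s # ys @ [t])"
  proof (cases ys)
    case Nil
    \<comment> \<open>Without inner vertices the run is the single edge from \<open>s\<close> to
      \<open>t\<close>.\<close>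
    then have V: "V = {s, t}" using ys(3) start target by auto
    have "length h = 2" using h V distinct distinct_card[OF h(2)] by auto
    then have "h = [s, t]" using h by (cases h rule: remdups_adj.cases) auto
    then have "g s \<le> ?d {s, t}" using gd[OF sV] gs[of t] V distinct by auto
    moreover have "walk_cost w h = g s" using sum V distinct by (simp add: insert_Diff_if)
    moreover have "1 * ?d {s, t} \<le> (\<alpha> + 1) / 2 * ?d {s, t}"
      using alpha g[OF sV] \<open>g s \<le> ?d {s, t}\<close> by (intro mult_right_mono) auto
    ultimately show ?thesis using Nil by simp
  next
    case (Cons y zs)
    have mem: "set ys \<subseteq> V - {t}" "s \<notin> set ys" using ys by auto
    have "successively (\<noteq>) ys"
      using ys(2) by (simp add: successively_conv_nth nth_eq_iff_index_eq)
    then have succ: "successively (\<lambda>x y. g x \<le> ?d {x, y} \<or> g y \<le> ?d {x, y}) ys"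
    proof (rule successively_mono)
      fix x y assume "x \<in> set ys" "y \<in> set ys" "x \<noteq> y"
      then show "g x \<le> ?d {x, y} \<or> g y \<le> ?d {x, y}"
        using gd[of x y] gd[of y x] pair[of x y] mem by (auto simp: insert_commute)
    qed
    have "sum_list (map g ys) \<le> (\<alpha> + 1) / 2 * walk_cost ?d ys
           + max (g (hd ys)) (\<alpha> - (\<alpha> - 1) / 2 * g (hd ys))"
      using Cons mem g succ by (intro sum_list_le_charged_cost) auto
    moreover have "max (g (hd ys)) (\<alpha> - (\<alpha> - 1) / 2 * g (hd ys)) \<le> \<alpha>"
      using g[of y] alpha mem Cons by auto
    ultimately have tail: "sum_list (map g ys) \<le> (\<alpha> + 1) / 2 * walk_cost ?d ys + \<alpha>"
      by linarith
    \<comment> \<open>The run leaves \<open>s\<close> first and \<open>y\<close> is not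
      \<open>t\<close>, so the first pair is charged to \<open>s\<close>.\<close>
    have "g s \<le> ?d {s, y}"
      using gd[OF sV] gs[of y] mem Cons by auto
    then have "(\<alpha> + 1) / 2 * g s \<le> (\<alpha> + 1) / 2 * ?d {s, y}"
      using alpha by (intro mult_left_mono) auto
    \<comment> \<open>The slack at \<open>s\<close> is \<open>(\<alpha> - 1) / 2 * g s\<close>,
      hence at least \<open>(\<alpha> - 1) / 2\<close>.\<close>
    moreover have "(\<alpha> - 1) * 1 \<le> (\<alpha> - 1) * g s"
      using alpha g[OF sV] by (intro mult_left_mono) auto
    ultimately have head: "g s + (\<alpha> - 1) / 2 \<le> (\<alpha> + 1) / 2 * ?d {s, y}"
      by (simp add: field_simps)
    \<comment> \<open>The hop into \<open>t\<close> contributes at least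
      \<open>(\<alpha> + 1) / 2\<close>; with the slack \<open>(\<alpha> - 1) / 2\<close> at
      \<open>s\<close> this yields exactly the excess \<alpha> left over in
      \<open>tail\<close>.\<close>
    have "(\<alpha> + 1) / 2 * 1 \<le> (\<alpha> + 1) / 2 * ?d {last ys, t}"
      using alpha w_bounds(1) by (intro mult_left_mono capped_ge_one) auto
    moreover have "walk_cost ?d (s # ys @ [t]) = ?d {s, y} + walk_cost ?d ys + ?d {last ys, t}"
      using walk_cost_append_last[of ys ?d t] Cons by simp
    moreover have "V - {t} = insert s (set ys)" using ys sV by auto
    then have "walk_cost w h = g s + sum_list (map g ys)"
      using sum mem(2) ys(2) by (simp add: sum_list_distinct_conv_sum_set)
    ultimately show ?thesis using head tail by (simp add: field_simps)
  qed
  also have "\<dots> \<le> (\<alpha> + 1) / 2 * walk_cost w p"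
    using le alpha by (intro mult_left_mono) auto
  finally show ?thesis .
qed

lemma adaptive_run_competitive:
  assumes "adaptive_run V E u s t w h"
  shows "visiting_walk V E s t V h \<and> walk_cost w h \<le> (\<alpha> + 1) / 2 * OPT V E s t w"
proof -
  have h: "hamiltonian_path V E s t h" "greedy_path V E w t h"
    using adaptive_run_greedy[OF assms] by auto
  have vis: "visiting_walk V E s t V h"
    using h(1) by (auto simp: hamiltonian_path_def path_def visiting_walk_def)
  \<comment> \<open>Dividing by the ratio turns the comparison with each single walk into a lower
    bound for the infimum.\<close>
  have "walk_cost w h / ((\<alpha> + 1) / 2) \<le> OPT V E s t w"
    unfolding OPT_def
  proof (rule cINF_greatest)
    show "{p. visiting_walk V E s t V p} \<noteq> {}" using vis by blast
    fix p assume "p \<in> {p. visiting_walk V E s t V p}"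
    then show "walk_cost w h / ((\<alpha> + 1) / 2) \<le> walk_cost w p"
      using greedy_cost_le[OF h, of p] alpha by (simp add: field_simps)
  qed
  then show ?thesis using vis alpha by (simp add: field_simps)
qed

end

theorem theorem3:
  fixes \<alpha> :: real
    and V :: "'a set" and E :: "'a set set"
    and l u w :: "'a set \<Rightarrow> real"
    and s t :: 'a
  assumes "1 \<le> \<alpha>" and "\<alpha> < 2"
    and "geewe_instance V E l u s t w"
    and "\<And>e. e \<in> E \<Longrightarrow> l e = 1 \<and> u e = \<alpha>"
    and "\<And>p. path V E p \<Longrightarrow> hd p = s \<Longrightarrow> t \<notin> set p \<Longrightarrow> \<exists>q. hamiltonian_path V E s t (p @ q)"
  shows "adaptive_terminates V E u s t w \<and>
    (\<forall>h. adaptive_run V E u s t w h \<longrightarrow>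
       visiting_walk V E s t V h \<and> walk_cost w h \<le> (\<alpha> + 1) / 2 * OPT V E s t w)"
proof -
  interpret geewe_instance V E l u s t w by (rule assms(3))
  interpret extendable_instance V E l u s t w \<alpha>
    by unfold_locales (use assms in auto)
  show ?thesis using adaptive_terminates adaptive_run_competitive by blast
qed

end
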